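(* Let $G$ be an infinite group and let $W\subseteq G$. (1) If $W$ is finite and nonempty, then no asymptotic complement of $W$ in $G$ contains a minimal asymptotic complement of $W$, and $W$ does not admit any minimal asymptotic complement in $G$. (2) If $G\setminus W$ is finite and nonempty, then $W$ admits a minimal complement in $G$ of cardinality two, and the singleton subsets of $G$ are precisely the minimal asymptotic complements of $W$ in $G$.
   Context: For nonempty subsets $A,B$ of a group $G$, $AB=\{ab : a\in A, b\in B\}$. Given nonempty $W,C\subseteq G$: $C$ is a complement to $W$ if $WC=G$; $C$ is a minimal complement to $W$ if $C$ is a complement to $W$ but $C\setminus\{c\}$ is not a complement to $W$ for every $c\in C$. $C$ is an asymptotic complement to $W$ if there is a finite subset $F\subseteq G$ with $WC=G\setminus F$; $C$ is a minimal asymptotic complement to $W$ if $C$ is an asymptotic complement to $W$ but $C\setminus\{c\}$ is not an asymptotic complement to $W$ for every $c\in C$. *)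

theory Defs
  imports "HOL-Algebra.Coset"
begin

definition complement_to :: "('a, 'b) monoid_scheme \<Rightarrow> 'a set \<Rightarrow> 'a set \<Rightarrow> bool" where
  "complement_to G W C \<longleftrightarrow>
     W \<subseteq> carrier G \<and> W \<noteq> {} \<and> C \<subseteq> carrier G \<and> C \<noteq> {} \<and>
     W <#>\<^bsub>G\<^esub> C = carrier G"

definition minimal_complement_to :: "('a, 'b) monoid_scheme \<Rightarrow> 'a set \<Rightarrow> 'a set \<Rightarrow> bool" where
  "minimal_complement_to G W C \<longleftrightarrow>
     complement_to G W C \<and> (\<forall>c\<in>C. \<not> complement_to G W (C - {c}))"

definition asymptotic_complement_to :: "('a, 'b) monoid_scheme \<Rightarrow> 'a set \<Rightarrow> 'a set \<Rightarrow> bool" where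
  "asymptotic_complement_to G W C \<longleftrightarrow>
     W \<subseteq> carrier G \<and> W \<noteq> {} \<and> C \<subseteq> carrier G \<and> C \<noteq> {} \<and>
     (\<exists>F. finite F \<and> F \<subseteq> carrier G \<and> W <#>\<^bsub>G\<^esub> C = carrier G - F)"

definition minimal_asymptotic_complement_to ::
    "('a, 'b) monoid_scheme \<Rightarrow> 'a set \<Rightarrow> 'a set \<Rightarrow> bool" where
  "minimal_asymptotic_complement_to G W C \<longleftrightarrow>
     asymptotic_complement_to G W C \<and>
     (\<forall>c\<in>C. \<not> asymptotic_complement_to G W (C - {c}))"

end

theory Submission
  imports Defs
begin

text \<open>View \<open>W <#> C\<close> as the union of the right translates \<open>W c\<close>,
  \<open>c\<close> in \<open>C\<close>. If \<open>W\<close> is finite, each translate is finite, so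
  covering all but finitely many points of an infinite group takes infinitely many \<open>c\<close>.
  Deleting one of them loses at most a finite set, so what remains is still an asymptotic complement
  and none is minimal (\<open>asymptotic_complement_remove\<close>). If \<open>F = G - W\<close> is
  finite, a single translate \<open>W c\<close> misses only the finite set \<open>F c\<close>. Hence
  every nonempty \<open>C\<close> is an asymptotic complement
  (\<open>cofinite_imp_asymptotic_complement\<close>), and the minimal nonempty sets are the
  singletons. For exact complements with \<open>F\<close> nonempty, one translate is too little,
  while \<open>W\<close> and \<open>W g\<close> together miss just the intersection of
  \<open>F\<close> and \<open>F g\<close>, which is empty for a suitable \<open>g\<close>.\<close>

lemma (in group) mem_set_mult_iff:
  assumes "W \<subseteq> carrier G" "C \<subseteq> carrier G" "x \<in> carrier G"
  shows "x \<in> W <#> C \<longleftrightarrow> (\<exists>c\<in>C. x \<otimes> inv c \<in> W)"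
proof
  assume "x \<in> W <#> C"
  then obtain w c where wc: "w \<in> W" "c \<in> C" "x = w \<otimes> c"
    unfolding set_mult_def by blast
  with assms have "x \<otimes> inv c = w"
    by (metis inv_solve_right' subsetD)
  with wc show "\<exists>c\<in>C. x \<otimes> inv c \<in> W"
    by metis
next
  assume "\<exists>c\<in>C. x \<otimes> inv c \<in> W"
  then obtain c where c: "c \<in> C" "x \<otimes> inv c \<in> W"
    by blast
  with assms have "x = (x \<otimes> inv c) \<otimes> c"
    by (simp add: m_assoc subset_iff)
  with c show "x \<in> W <#> C"
    unfolding set_mult_def by auto
qed

text \<open>The exceptional set is determined by the product, so the existential witness can be
  replaced by the set of missed points, whose finiteness is easy to bound.\<close>

lemma (in group) asymptotic_complement_to_iff:
  "asymptotic_complement_to G W C \<longleftrightarrow>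
     W \<subseteq> carrier G \<and> W \<noteq> {} \<and> C \<subseteq> carrier G \<and> C \<noteq> {} \<and>
     finite (carrier G - (W <#> C))"
proof -
  have "(\<exists>F. finite F \<and> F \<subseteq> carrier G \<and> W <#> C = carrier G - F)
        \<longleftrightarrow> finite (carrier G - (W <#> C))"
    if "W \<subseteq> carrier G" "C \<subseteq> carrier G"
  proof
    assume "\<exists>F. finite F \<and> F \<subseteq> carrier G \<and> W <#> C = carrier G - F"
    then show "finite (carrier G - (W <#> C))"
      by (auto simp: double_diff)
  next
    assume fin: "finite (carrier G - (W <#> C))"
    have "W <#> C = carrier G - (carrier G - (W <#> C))"
      using set_mult_closed[OF that] by blast
    with fin show "\<exists>F. finite F \<and> F \<subseteq> carrier G \<and> W <#> C = carrier G - F"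
      by blast
  qed
  then show ?thesis
    unfolding asymptotic_complement_to_def by blast
qed

text \<open>Otherwise \<open>W <#> C\<close> would be finite as well as cofinite, forcing
  \<open>G\<close> to be finite.\<close>

lemma (in group) infinite_asymptotic_complement:
  assumes "infinite (carrier G)" "finite W" "asymptotic_complement_to G W C"
  shows "infinite C"
proof
  assume "finite C"
  with \<open>finite W\<close> have "finite (W <#> C)"
    unfolding set_mult_def by blast
  moreover have "finite (carrier G - (W <#> C))"
    using assms(3) unfolding asymptotic_complement_to_iff by blast
  ultimately show False
    using \<open>infinite (carrier G)\<close> by (meson finite_Diff2)
qed

text \<open>Only points of the finite translate \<open>W c\<close> can become uncovered; infinitude
  of \<open>C\<close> keeps \<open>C - {c}\<close> nonempty.\<close>

lemma (in group) asymptotic_complement_remove: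
  assumes "infinite (carrier G)" "finite W" "asymptotic_complement_to G W C"
  shows "asymptotic_complement_to G W (C - {c})"
proof -
  have "C - {c} \<noteq> {}"
    using infinite_asymptotic_complement[OF assms] by (metis finite.emptyI finite_Diff_insert Diff_empty)
  moreover have "finite (carrier G - (W <#> (C - {c})))"
  proof (rule finite_subset)
    show "carrier G - (W <#> (C - {c})) \<subseteq> (carrier G - (W <#> C)) \<union> (\<lambda>w. w \<otimes> c) ` W"
      unfolding set_mult_def by blast
    show "finite ((carrier G - (W <#> C)) \<union> (\<lambda>w. w \<otimes> c) ` W)"
      using assms unfolding asymptotic_complement_to_iff by blast
  qed
  ultimately show ?thesis
    using assms(3) unfolding asymptotic_complement_to_iff by blast
qed

lemma (in group) not_minimal_asymptotic_complement_if_finite: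
  assumes "infinite (carrier G)" "finite W"
  shows "\<not> minimal_asymptotic_complement_to G W C"
proof
  assume min: "minimal_asymptotic_complement_to G W C"
  then have asym: "asymptotic_complement_to G W C"
    unfolding minimal_asymptotic_complement_to_def by blast
  then obtain c where "c \<in> C"
    unfolding asymptotic_complement_to_def by blast
  with min asymptotic_complement_remove[OF assms asym] show False
    unfolding minimal_asymptotic_complement_to_def by blast
qed

text \<open>One element \<open>c\<close> of \<open>C\<close> suffices: points missed by
  \<open>W <#> C\<close> lie in the right translate of \<open>carrier G - W\<close> by
  \<open>c\<close>.\<close>

lemma (in group) cofinite_imp_asymptotic_complement:
  assumes "W \<subseteq> carrier G" "W \<noteq> {}" "finite (carrier G - W)" "C \<subseteq> carrier G" "C \<noteq> {}"
  shows "asymptotic_complement_to G W C"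
proof -
  obtain c where c: "c \<in> C" "c \<in> carrier G"
    using assms by blast
  have "carrier G - (W <#> C) \<subseteq> (\<lambda>x. x \<otimes> c) ` (carrier G - W)"
  proof
    fix x assume x: "x \<in> carrier G - (W <#> C)"
    with c assms have "x \<otimes> inv c \<in> carrier G - W"
      by (auto simp: mem_set_mult_iff)
    moreover have "x = (x \<otimes> inv c) \<otimes> c"
      using x c by (simp add: m_assoc)
    ultimately show "x \<in> (\<lambda>x. x \<otimes> c) ` (carrier G - W)"
      by blast
  qed
  with assms show ?thesis
    unfolding asymptotic_complement_to_iff by (meson finite_imageI finite_subset)
qed

lemma (in group) minimal_asymptotic_complement_iff_singleton:
  assumes "W \<subseteq> carrier G" "W \<noteq> {}" "finite (carrier G - W)"
  shows "minimal_asymptotic_complement_to G W C \<longleftrightarrow> (\<exists>g\<in>carrier G. C = {g})"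
proof
  assume min: "minimal_asymptotic_complement_to G W C"
  then have C: "C \<subseteq> carrier G" "C \<noteq> {}"
    unfolding minimal_asymptotic_complement_to_def asymptotic_complement_to_def by auto
  then obtain g where g: "g \<in> C"
    by blast
  \<comment> \<open>Deleting \<open>d\<close> distinct from \<open>g\<close> would leave
    \<open>g\<close> behind, and any nonempty set is still an asymptotic complement.\<close>
  have "d = g" if "d \<in> C" for d
  proof (rule ccontr)
    assume "d \<noteq> g"
    with g C have "asymptotic_complement_to G W (C - {d})"
      by (intro cofinite_imp_asymptotic_complement assms) auto
    with min that show False
      unfolding minimal_asymptotic_complement_to_def by blast
  qed
  with g C show "\<exists>g\<in>carrier G. C = {g}"
    by blast
next
  assume "\<exists>g\<in>carrier G. C = {g}"
  then obtain g where "g \<in> carrier G" "C = {g}"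
    by blast
  \<comment> \<open>Minimality is immediate: deleting \<open>g\<close> leaves the empty set, which
    the definition excludes.\<close>
  with cofinite_imp_asymptotic_complement[OF assms, of C]
  show "minimal_asymptotic_complement_to G W C"
    by (simp add: minimal_asymptotic_complement_to_def asymptotic_complement_to_def)
qed

text \<open>Right translation by \<open>c\<close> is injective, so a point \<open>f\<close> outside
  \<open>W\<close> gives the point \<open>f c\<close> outside \<open>W c\<close>.\<close>

lemma (in group) not_complement_singleton:
  assumes "W \<subset> carrier G"
  shows "\<not> complement_to G W {c}"
proof
  assume comp: "complement_to G W {c}"
  then have c: "c \<in> carrier G"
    unfolding complement_to_def by blast
  obtain f where f: "f \<in> carrier G" "f \<notin> W"
    using assms by blast
  have "f \<otimes> c \<in> W <#> {c}"
    using comp f c unfolding complement_to_def by simp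
  then have "(f \<otimes> c) \<otimes> inv c \<in> W"
    using assms c f by (subst (asm) mem_set_mult_iff) auto
  with f c show False
    by (simp add: m_assoc)
qed

text \<open>With \<open>F = G - W\<close>, the pair \<open>{1, g}\<close> is a complement as soon as \<open>F\<close> and \<open>F g\<close> are disjoint,
  that is, as soon as \<open>g\<close> avoids the finite set \<open>F\<^sup>-\<^sup>1 F\<close>.\<close>

lemma (in group) ex_minimal_complement_card_2:
  assumes "infinite (carrier G)" "W \<subset> carrier G" "finite (carrier G - W)"
  shows "\<exists>C. minimal_complement_to G W C \<and> card C = 2"
proof -
  define F where "F = carrier G - W"
  obtain f where f: "f \<in> F"
    using assms unfolding F_def by blast
  have "W \<noteq> {}"
    using assms by auto
  have "finite ((\<lambda>(a, b). inv a \<otimes> b) ` (F \<times> F))"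
    using assms unfolding F_def by blast
  then obtain g where g: "g \<in> carrier G" "g \<notin> (\<lambda>(a, b). inv a \<otimes> b) ` (F \<times> F)"
    using assms(1) by (meson finite_subset subsetI)
  \<comment> \<open>Since \<open>F\<close> is nonempty, the avoided set contains
    \<open>\<one>\<close> as \<open>inv f \<otimes> f\<close>; thus the pair really has two
    elements.\<close>
  have "g \<noteq> \<one>"
  proof
    assume "g = \<one>"
    then have "g = inv f \<otimes> f"
      using f unfolding F_def by simp
    with f g show False
      by force
  qed
  have "x \<in> W <#> {\<one>, g}" if x: "x \<in> carrier G" for x
  proof (rule ccontr)
    assume "x \<notin> W <#> {\<one>, g}"
    then have xF: "x \<in> F" "x \<otimes> inv g \<in> F"
      using assms x g by (auto simp: mem_set_mult_iff F_def)
    have "g = inv (x \<otimes> inv g) \<otimes> x"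
      using x g by (simp add: inv_mult_group m_assoc)
    with xF g show False
      by force
  qed
  then have "complement_to G W {\<one>, g}"
    using assms g \<open>W \<noteq> {}\<close> set_mult_closed[of W "{\<one>, g}"]
    unfolding complement_to_def by blast
  moreover have "\<not> complement_to G W ({\<one>, g} - {c})" if "c \<in> {\<one>, g}" for c
  proof -
    have "{\<one>, g} - {c} = {\<one>} \<or> {\<one>, g} - {c} = {g}"
      using that \<open>g \<noteq> \<one>\<close> by auto
    then show ?thesis
      using not_complement_singleton[OF assms(2)] by auto
  qed
  ultimately have "minimal_complement_to G W {\<one>, g}"
    unfolding minimal_complement_to_def by blast
  moreover have "card {\<one>, g} = 2"
    using \<open>g \<noteq> \<one>\<close> by auto
  ultimately show ?thesis
    by blast
qed

theorem theoremA:
  fixes G :: "('a, 'b) monoid_scheme" and W :: "'a set"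
  assumes "group G" and "infinite (carrier G)" and "W \<subseteq> carrier G"
  shows "(finite W \<and> W \<noteq> {} \<longrightarrow>
           (\<forall>C. asymptotic_complement_to G W C \<longrightarrow>
                \<not> (\<exists>M. M \<subseteq> C \<and> minimal_asymptotic_complement_to G W M)) \<and>
           \<not> (\<exists>M. minimal_asymptotic_complement_to G W M)) \<and>
         (finite (carrier G - W) \<and> carrier G - W \<noteq> {} \<longrightarrow>
           (\<exists>C. minimal_complement_to G W C \<and> card C = 2) \<and>
           {C. minimal_asymptotic_complement_to G W C} = {{g} | g. g \<in> carrier G})"
proof -
  interpret group G by fact
  show ?thesis
  proof (intro conjI impI)
    assume "finite W \<and> W \<noteq> {}"
    \<comment> \<open>Nonexistence for arbitrary \<open>M\<close> yields both claims at
      once.\<close>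
    then have "\<not> minimal_asymptotic_complement_to G W M" for M
      using not_minimal_asymptotic_complement_if_finite assms(2) by blast
    then show "\<forall>C. asymptotic_complement_to G W C \<longrightarrow>
                \<not> (\<exists>M. M \<subseteq> C \<and> minimal_asymptotic_complement_to G W M)"
      and "\<not> (\<exists>M. minimal_asymptotic_complement_to G W M)"
      by blast+
  next
    assume cofin: "finite (carrier G - W) \<and> carrier G - W \<noteq> {}"
    then show "\<exists>C. minimal_complement_to G W C \<and> card C = 2"
      using assms by (intro ex_minimal_complement_card_2) auto
    \<comment> \<open>An empty \<open>W\<close> would leave all of the infinite group as its
      complement.\<close>
    have "W \<noteq> {}"
      using cofin assms(2) by auto
    with cofin assms(3)
    show "{C. minimal_asymptotic_complement_to G W C} = {{g} | g. g \<in> carrier G}"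
      by (auto simp: minimal_asymptotic_complement_iff_singleton)
  qed
qed

end
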